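(* Let $X$ and $Y$ be nonempty metric spaces and let $c\colon X\times Y\to\mathbb{R}\cup\{+\infty\}$ be a cost whose domain $D$ is nonempty and open in $X\times Y$. Let $G$ be a nonempty subset of $D$ that is topologically connected, or ball chain connected, or strongly connected. If $G$ is $c$-cyclically monotone, then $G$ is $c$-path bounded, $c$-potentiable, and it has a $c$-antiderivative.
   Context: $D:=\{(x,y)\in X\times Y: c(x,y)<+\infty\}$. $X\times Y$ carries the metric $d((x,y),(u,v))=\sqrt{d_X(x,u)^2+d_Y(y,v)^2}$, with open balls $\mathcal{B}_\rho(x,y)$, $\rho\in\,]0,+\infty]$. Conventions: $r-(+\infty)=-\infty$ for $r\in\mathbb{R}$, $\sup\varnothing=-\infty$, $\inf\varnothing=+\infty$. Maximal ball: for $(x,y)\in D$, $\rho(x,y):=\sup\{\rho>0:\mathcal{B}_\rho(x,y)\subseteq D\}$ and $\mathcal{B}(x,y):=\mathcal{B}_{\rho(x,y)}(x,y)$. Ball chain: a ball chain in $G$ from $(x_s,y_s)\in G$ to $(x_e,y_e)\in G$ is a finite sequence $((x_k,y_k))_{k=1}^{N+1}$ in $G$ ($N\ge1$) with $(x_1,y_1)=(x_s,y_s)$, $(x_{N+1},y_{N+1})=(x_e,y_e)$ and $\mathcal{B}(x_k,y_k)\cap\mathcal{B}(x_{k+1},y_{k+1})\cap G\ne\varnothing$ for every $k\in\{1,\dots,N\}$. $G$ is ball chain connected if any two of its points are joined by a ball chain in $G$. Path: a path in $G$ from $(x_s,y_s)\in G$ to $(x_e,y_e)\in G$ is a finite sequence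 $((x_k,y_k))_{k=1}^{N+1}$ in $G$ ($N\ge1$) with $(x_1,y_1)=(x_s,y_s)$, $(x_{N+1},y_{N+1})=(x_e,y_e)$ and $c(x_{k+1},y_k)<+\infty$ for $k\in\{1,\dots,N\}$. $G$ is strongly connected if for any two points of $G$ there is a path in $G$ from each to the other. $F_G\big((x_s,y_s),(x_e,y_e)\big):=\sup\sum_{k=1}^N\big(c(x_k,y_k)-c(x_{k+1},y_k)\big)$ over all paths in $G$ from $(x_s,y_s)$ to $(x_e,y_e)$. $G$ is $c$-path bounded if $F_G<+\infty$ on $G\times G$; $G$ is $c$-cyclically monotone if $F_G\big((x,y),(x,y)\big)\le0$ for all $(x,y)\in G$. A $c$-antiderivative of $G$ is a function $f\colon G\to\mathbb{R}$ with $c(x,y)-c(u,y)\le f(x,y)-f(u,v)$ for all $(x,y),(u,v)\in G$. $c$-potentiability: for $\psi\colon X\to[-\infty,+\infty]$, $\psi^c(y):=\inf\{c(x,y)-\psi(x): x\in X,(x,y)\in D\}$; for $\varphi\colon Y\to[-\infty,+\infty]$, $\varphi^{\overline c}(x):=\inf\{c(x,y)-\varphi(y):y\in Y,(x,y)\in D\}$. A $c$-class function is a $\psi\colon X\to[-\infty,+\infty]$ of the form $\psi=\varphi^{\overline c}$. $G$ is $c$-potentiable if there is a $c$-class function $\psi$ such that every $(x,y)\in G$ satisfies $\psi(x)\in\mathbb{R}$ and $\psi(x)+\psi^c(y)=c(x,y)<+\infty$. *)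

theory Defs
  imports "HOL-Analysis.Analysis"
begin

text \<open>
  The metric spaces \<open>X\<close> and \<open>Y\<close> are the universes of the (nonempty) types \<open>'a\<close> and \<open>'b\<close>; the
  library metric on \<open>'a \<times> 'b\<close> is \<open>sqrt (d_X\<^sup>2 + d_Y\<^sup>2)\<close>. A cost is a function
  into \<^typ>\<open>ereal\<close>; that it avoids \<open>-\<infinity>\<close> is an explicit hypothesis where needed.
  On \<^typ>\<open>ereal\<close>, a real minus \<open>\<infinity>\<close> is \<open>-\<infinity>\<close>, \<open>Sup {} = -\<infinity>\<close> and \<open>Inf {} = \<infinity>\<close>.
\<close>

definition cost_dom :: "('a \<Rightarrow> 'b \<Rightarrow> ereal) \<Rightarrow> ('a \<times> 'b) set" where
  "cost_dom c = {(x, y). c x y < \<infinity>}"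

text \<open>The radius may be infinite, so the library's \<^const>\<open>ball\<close> does not apply.\<close>

definition ext_ball :: "'a::metric_space \<Rightarrow> ereal \<Rightarrow> 'a set" where
  "ext_ball z r = {w. ereal (dist z w) < r}"

definition max_radius ::
  "('a::metric_space \<Rightarrow> 'b::metric_space \<Rightarrow> ereal) \<Rightarrow> 'a \<times> 'b \<Rightarrow> ereal" where
  "max_radius c z = Sup {r. 0 < r \<and> ext_ball z r \<subseteq> cost_dom c}"

definition max_ball ::
  "('a::metric_space \<Rightarrow> 'b::metric_space \<Rightarrow> ereal) \<Rightarrow> 'a \<times> 'b \<Rightarrow> ('a \<times> 'b) set" where
  "max_ball c z = ext_ball z (max_radius c z)"

text \<open>
  A finite sequence \<open>z\<^sub>1, \<dots>, z\<^sub>N\<^sub>+\<^sub>1\<close> is given by \<open>N\<close> and a function on \<^typ>\<open>nat\<close>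
  of which only the values at \<open>1, \<dots>, N + 1\<close> matter.
\<close>

definition ball_chain ::
  "('a::metric_space \<Rightarrow> 'b::metric_space \<Rightarrow> ereal) \<Rightarrow> ('a \<times> 'b) set \<Rightarrow> 'a \<times> 'b \<Rightarrow> 'a \<times> 'b
    \<Rightarrow> nat \<Rightarrow> (nat \<Rightarrow> 'a \<times> 'b) \<Rightarrow> bool" where
  "ball_chain c G s e N z \<longleftrightarrow>
     1 \<le> N \<and> (\<forall>k\<in>{1..N+1}. z k \<in> G) \<and> z 1 = s \<and> z (N+1) = e \<and>
     (\<forall>k\<in>{1..N}. max_ball c (z k) \<inter> max_ball c (z (k+1)) \<inter> G \<noteq> {})"

definition ball_chain_connected ::
  "('a::metric_space \<Rightarrow> 'b::metric_space \<Rightarrow> ereal) \<Rightarrow> ('a \<times> 'b) set \<Rightarrow> bool" where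
  "ball_chain_connected c G \<longleftrightarrow> (\<forall>s\<in>G. \<forall>e\<in>G. \<exists>N z. ball_chain c G s e N z)"

definition cost_path ::
  "('a \<Rightarrow> 'b \<Rightarrow> ereal) \<Rightarrow> ('a \<times> 'b) set \<Rightarrow> 'a \<times> 'b \<Rightarrow> 'a \<times> 'b
    \<Rightarrow> nat \<Rightarrow> (nat \<Rightarrow> 'a \<times> 'b) \<Rightarrow> bool" where
  "cost_path c G s e N z \<longleftrightarrow>
     1 \<le> N \<and> (\<forall>k\<in>{1..N+1}. z k \<in> G) \<and> z 1 = s \<and> z (N+1) = e \<and>
     (\<forall>k\<in>{1..N}. c (fst (z (k+1))) (snd (z k)) < \<infinity>)"

definition strongly_connected :: "('a \<Rightarrow> 'b \<Rightarrow> ereal) \<Rightarrow> ('a \<times> 'b) set \<Rightarrow> bool" where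
  "strongly_connected c G \<longleftrightarrow>
     (\<forall>s\<in>G. \<forall>e\<in>G. (\<exists>N z. cost_path c G s e N z) \<and> (\<exists>N z. cost_path c G e s N z))"

definition path_sup ::
  "('a \<Rightarrow> 'b \<Rightarrow> ereal) \<Rightarrow> ('a \<times> 'b) set \<Rightarrow> 'a \<times> 'b \<Rightarrow> 'a \<times> 'b \<Rightarrow> ereal" where
  "path_sup c G s e =
     Sup {(\<Sum>k=1..N. c (fst (z k)) (snd (z k)) - c (fst (z (k+1))) (snd (z k))) | N z.
            cost_path c G s e N z}"

definition path_bounded :: "('a \<Rightarrow> 'b \<Rightarrow> ereal) \<Rightarrow> ('a \<times> 'b) set \<Rightarrow> bool" where
  "path_bounded c G \<longleftrightarrow> (\<forall>s\<in>G. \<forall>e\<in>G. path_sup c G s e < \<infinity>)"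

definition cyclically_monotone :: "('a \<Rightarrow> 'b \<Rightarrow> ereal) \<Rightarrow> ('a \<times> 'b) set \<Rightarrow> bool" where
  "cyclically_monotone c G \<longleftrightarrow> (\<forall>z\<in>G. path_sup c G z z \<le> 0)"

text \<open>Only the values of \<open>f\<close> on \<open>G\<close> matter.\<close>

definition antiderivative ::
  "('a \<Rightarrow> 'b \<Rightarrow> ereal) \<Rightarrow> ('a \<times> 'b) set \<Rightarrow> ('a \<times> 'b \<Rightarrow> real) \<Rightarrow> bool" where
  "antiderivative c G f \<longleftrightarrow>
     (\<forall>(x, y)\<in>G. \<forall>(u, v)\<in>G. c x y - c u y \<le> ereal (f (x, y) - f (u, v)))"

definition c_transform :: "('a \<Rightarrow> 'b \<Rightarrow> ereal) \<Rightarrow> ('a \<Rightarrow> ereal) \<Rightarrow> 'b \<Rightarrow> ereal" where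
  "c_transform c \<psi> y = Inf {c x y - \<psi> x | x. (x, y) \<in> cost_dom c}"

definition cbar_transform :: "('a \<Rightarrow> 'b \<Rightarrow> ereal) \<Rightarrow> ('b \<Rightarrow> ereal) \<Rightarrow> 'a \<Rightarrow> ereal" where
  "cbar_transform c \<phi> x = Inf {c x y - \<phi> y | y. (x, y) \<in> cost_dom c}"

definition c_class :: "('a \<Rightarrow> 'b \<Rightarrow> ereal) \<Rightarrow> ('a \<Rightarrow> ereal) \<Rightarrow> bool" where
  "c_class c \<psi> \<longleftrightarrow> (\<exists>\<phi>. \<psi> = cbar_transform c \<phi>)"

definition potentiable :: "('a \<Rightarrow> 'b \<Rightarrow> ereal) \<Rightarrow> ('a \<times> 'b) set \<Rightarrow> bool" where
  "potentiable c G \<longleftrightarrow>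
     (\<exists>\<psi>. c_class c \<psi> \<and>
        (\<forall>(x, y)\<in>G. \<bar>\<psi> x\<bar> \<noteq> \<infinity> \<and> \<psi> x + c_transform c \<psi> y = c x y \<and> c x y < \<infinity>))"

end

theory Submission
  imports Defs
begin

text \<open>
  Call two points of \<open>G\<close> linked when paths lead from each to the other. The three connectedness
  hypotheses reduce to strong connectedness, that is, all points are linked
  (\<open>strongly_connected_if_connected\<close>, \<open>strongly_connected_if_ball_chain_connected\<close>): a ball
  around \<open>(x, y)\<close> that lies in the domain and contains \<open>(u, v)\<close> also contains the two corners
  \<open>(u, y)\<close> and \<open>(x, v)\<close>, because moving a single coordinate only costs part of the distance.
  Finite cost at these corners is what makes one-step paths between \<open>(x, y)\<close> and \<open>(u, v)\<close> in
  both directions. Linkedness is thus an equivalence relation on \<open>G\<close> that holds between nearby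
  points, and between consecutive points of a ball chain.

  In a strongly connected \<open>G\<close>, any path from \<open>s\<close> to \<open>e\<close> can be closed by one and the same path
  from \<open>e\<close> back to \<open>s\<close>; cyclical monotonicity says that the closed path gains at most \<open>0\<close>, so the
  gain of the first path is at most minus the gain of the second
  (\<open>path_bounded_if_strongly_connected\<close>). Hence \<open>F(z, t)\<close> is a real number for all \<open>z\<close> and
  \<open>t\<close>, and for fixed \<open>t\<close> the function \<open>f = F(\<cdot>, t)\<close> is an antiderivative: prefixing a path with one
  step from \<open>(x, y)\<close> to \<open>(u, v)\<close> adds \<open>c(x, y) - c(u, y)\<close> to its gain
  (\<open>antiderivative_if_path_bounded\<close>).

  Finally, an antiderivative \<open>f\<close> gives a potential (\<open>potentiable_if_antiderivative\<close>): the
  inequality with both points over the same \<open>y\<close> shows that \<open>\<phi>(y) = c(x, y) - f(x, y)\<close> does not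
  depend on the choice of \<open>(x, y) \<in> G\<close>, and with \<open>\<phi> = -\<infinity>\<close> elsewhere the transform
  of \<open>\<phi>\<close> extends \<open>f\<close>.
\<close>

section \<open>Gains of paths\<close>

definition path_gain :: "('a \<Rightarrow> 'b \<Rightarrow> ereal) \<Rightarrow> nat \<Rightarrow> (nat \<Rightarrow> 'a \<times> 'b) \<Rightarrow> ereal" where
  "path_gain c N z =
     (\<Sum>k=1..N. c (fst (z k)) (snd (z k)) - c (fst (z (k+1))) (snd (z k)))"

lemma path_sup_eq: "path_sup c G s e = Sup {path_gain c N z | N z. cost_path c G s e N z}"
  by (simp add: path_sup_def path_gain_def)

lemma path_gain_le_path_sup: "cost_path c G s e N z \<Longrightarrow> path_gain c N z \<le> path_sup c G s e"
  unfolding path_sup_eq by (rule Sup_upper) blast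

lemma cost_path_step:
  assumes "s \<in> G" "e \<in> G" "c (fst e) (snd s) < \<infinity>"
  shows "\<exists>z. cost_path c G s e 1 z \<and>
           path_gain c 1 z = c (fst s) (snd s) - c (fst e) (snd s)"
  using assms
  by (intro exI[of _ "\<lambda>k. if k = 1 then s else e"]) (auto simp: cost_path_def path_gain_def)

lemma cost_path_append:
  assumes z: "cost_path c G s e N z" and w: "cost_path c G e t M w"
  shows "\<exists>L v. cost_path c G s t L v \<and> path_gain c L v = path_gain c N z + path_gain c M w"
proof -
  define v where "v k = (if k \<le> N then z k else w (k - N))" for k
  \<comment> \<open>At \<open>k = N + 1\<close> the value of \<open>v\<close> is \<open>w 1\<close>, which is the common point \<open>e = z (N + 1)\<close>.\<close>
  have v_left: "v k = z k" if "k \<le> N + 1" for k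
    using that z w by (cases "k = N + 1") (auto simp: v_def cost_path_def)
  have v_right: "v (N + k) = w k" if "1 \<le> k" for k
    using that by (simp add: v_def)
  have split: "k \<in> {1..N} \<or> (\<exists>j\<in>{1..M}. k = N + j)" if "k \<in> {1..N + M}" for k
  proof (cases "k \<le> N")
    case False
    with that show ?thesis by (intro disjI2 bexI[of _ "k - N"]) auto
  qed (use that in auto)
  have "cost_path c G s t (N + M) v"
    unfolding cost_path_def
  proof (intro conjI ballI)
    show "1 \<le> N + M" using z by (simp add: cost_path_def)
    show "v 1 = s" using z by (simp add: cost_path_def v_left)
    show "v (N + M + 1) = t"
      using w v_right[of "M + 1"] by (simp add: cost_path_def)
  next
    fix k assume "k \<in> {1..N + M + 1}"
    then consider "k \<in> {1..N}" | j where "j \<in> {1..M}" "k = N + j" | "k = N + (M + 1)"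
      using split[of k] by force
    then show "v k \<in> G"
    proof cases
      case 1
      then show ?thesis using z v_left[of k] by (auto simp: cost_path_def)
    next
      case 2
      then show ?thesis using w v_right[of j] by (auto simp: cost_path_def)
    next
      case 3
      have "\<forall>j\<in>{1..M + 1}. w j \<in> G" using w by (simp add: cost_path_def)
      then have "w (M + 1) \<in> G" by auto
      with 3 show ?thesis using v_right[of "M + 1"] by simp
    qed
  next
    fix k assume "k \<in> {1..N + M}"
    with split consider "k \<in> {1..N}" | j where "j \<in> {1..M}" "k = N + j"
      by blast
    then show "c (fst (v (k + 1))) (snd (v k)) < \<infinity>"
    proof cases
      case 1
      then show ?thesis using z v_left[of k] v_left[of "k + 1"] by (auto simp: cost_path_def)
    next
      case 2
      then show ?thesis using w v_right[of j] v_right[of "j + 1"] by (auto simp: cost_path_def)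
    qed
  qed
  moreover have "path_gain c (N + M) v = path_gain c N z + path_gain c M w"
  proof -
    define g where "g u k = c (fst (u k)) (snd (u k)) - c (fst (u (k+1))) (snd (u k))"
      for u :: "nat \<Rightarrow> 'a \<times> 'b" and k
    have "(\<Sum>k=1..N + M. g v k) = (\<Sum>k=1..N. g v k) + (\<Sum>k=N+1..N+M. g v k)"
      by (rule sum.ub_add_nat) simp
    also have "(\<Sum>k=1..N. g v k) = (\<Sum>k=1..N. g z k)"
      by (intro sum.cong refl) (simp add: g_def v_left)
    also have "(\<Sum>k=N+1..N+M. g v k) = (\<Sum>k=1..M. g v (k + N))"
      using sum.shift_bounds_cl_nat_ivl[of "g v" 1 N M] by (simp add: add.commute)
    also have "\<dots> = (\<Sum>k=1..M. g w k)"
    proof (intro sum.cong refl)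
      fix k assume "k \<in> {1..M}"
      then show "g v (k + N) = g w k"
        using v_right[of k] v_right[of "k + 1"] by (simp add: g_def ac_simps)
    qed
    finally show ?thesis by (simp add: path_gain_def g_def)
  qed
  ultimately show ?thesis by blast
qed

lemma path_gain_finite:
  assumes "\<And>x y. c x y \<noteq> -\<infinity>" "G \<subseteq> cost_dom c" "cost_path c G s e N z"
  shows "\<bar>path_gain c N z\<bar> \<noteq> \<infinity>"
proof -
  have "\<bar>c (fst (z k)) (snd (z k)) - c (fst (z (k+1))) (snd (z k))\<bar> \<noteq> \<infinity>" if "k \<in> {1..N}" for k
  proof -
    have "z k \<in> G" using assms(3) that by (auto simp: cost_path_def)
    then have "c (fst (z k)) (snd (z k)) < \<infinity>"
      using assms(2) by (auto simp: cost_dom_def)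
    moreover have "c (fst (z (k+1))) (snd (z k)) < \<infinity>"
      using assms(3) that by (auto simp: cost_path_def)
    ultimately show ?thesis
      using assms(1)[of "fst (z k)" "snd (z k)"] assms(1)[of "fst (z (k+1))" "snd (z k)"]
      by (cases "c (fst (z k)) (snd (z k))"; cases "c (fst (z (k+1))) (snd (z k))") auto
  qed
  then show ?thesis unfolding path_gain_def by (auto simp: sum_Inf)
qed

section \<open>Linked points and strong connectedness\<close>

definition linked :: "('a \<Rightarrow> 'b \<Rightarrow> ereal) \<Rightarrow> ('a \<times> 'b) set \<Rightarrow> 'a \<times> 'b \<Rightarrow> 'a \<times> 'b \<Rightarrow> bool" where
  "linked c G s e \<longleftrightarrow> (\<exists>N z. cost_path c G s e N z) \<and> (\<exists>N z. cost_path c G e s N z)"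

lemma strongly_connected_iff_linked:
  "strongly_connected c G \<longleftrightarrow> (\<forall>s\<in>G. \<forall>e\<in>G. linked c G s e)"
  by (simp add: strongly_connected_def linked_def)

lemma linked_sym: "linked c G s e \<Longrightarrow> linked c G e s"
  by (auto simp: linked_def)

lemma linked_trans: "linked c G s e \<Longrightarrow> linked c G e t \<Longrightarrow> linked c G s t"
  unfolding linked_def by (meson cost_path_append)

text \<open>
  The corners \<open>(u, y)\<close> and \<open>(x, v)\<close> are no farther from the centre \<open>(x, y)\<close> than \<open>(u, v)\<close> is.
\<close>

lemma linked_if_in_ext_ball:
  fixes c :: "'a::metric_space \<Rightarrow> 'b::metric_space \<Rightarrow> ereal"
  assumes "ext_ball p r \<subseteq> cost_dom c" "q \<in> ext_ball p r" "p \<in> G" "q \<in> G"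
  shows "linked c G p q"
proof -
  obtain x y u v where [simp]: "p = (x, y)" "q = (u, v)" by fastforce
  have "ereal (dist p q) < r" using assms(2) by (simp add: ext_ball_def)
  moreover have "dist p (u, y) \<le> dist p q"
    using dist_fst_le[of p q] by (simp add: dist_Pair_Pair)
  moreover have "dist p (x, v) \<le> dist p q"
    using dist_snd_le[of p q] by (simp add: dist_Pair_Pair)
  ultimately have "(u, y) \<in> ext_ball p r" "(x, v) \<in> ext_ball p r"
    unfolding ext_ball_def mem_Collect_eq
    by (meson ereal_less_eq(3) le_less_trans)+
  with assms(1) have "c u y < \<infinity>" "c x v < \<infinity>"
    by (auto simp: cost_dom_def)
  then show ?thesis
    using cost_path_step[of p G q c] cost_path_step[of q G p c] assms(3,4)
    by (auto simp: linked_def)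
qed

text \<open>
  The maximal radius is a supremum, so a point of the open maximal ball already lies in one of the
  balls contained in the domain.
\<close>

lemma linked_if_in_max_ball:
  fixes c :: "'a::metric_space \<Rightarrow> 'b::metric_space \<Rightarrow> ereal"
  assumes "q \<in> max_ball c p" "p \<in> G" "q \<in> G"
  shows "linked c G p q"
proof -
  have "ereal (dist p q) < max_radius c p"
    using assms(1) by (simp add: max_ball_def ext_ball_def)
  then obtain r where "ext_ball p r \<subseteq> cost_dom c" "ereal (dist p q) < r"
    by (auto simp: max_radius_def less_Sup_iff)
  then show ?thesis
    using linked_if_in_ext_ball[of p r c q G] assms(2,3) by (simp add: ext_ball_def)
qed

lemma strongly_connected_if_connected:
  fixes c :: "'a::metric_space \<Rightarrow> 'b::metric_space \<Rightarrow> ereal"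
  assumes "open (cost_dom c)" "G \<subseteq> cost_dom c" "connected G"
  shows "strongly_connected c G"
  unfolding strongly_connected_iff_linked
proof (intro ballI)
  fix s e assume "s \<in> G" "e \<in> G"
  with \<open>connected G\<close> show "linked c G s e"
  proof (rule connected_equivalence_relation)
    fix p assume "p \<in> G"
    with assms obtain r where r: "r > 0" "ball p r \<subseteq> cost_dom c"
      by (meson open_contains_ball subsetD)
    have "linked c G p q" if "q \<in> G \<inter> ball p r" for q
      using linked_if_in_ext_ball[of p "ereal r" c q G] r that \<open>p \<in> G\<close>
      by (auto simp: ext_ball_def ball_def)
    then show "\<exists>T. openin (top_of_set G) T \<and> p \<in> T \<and> (\<forall>q\<in>T. linked c G p q)"
      using r(1) \<open>p \<in> G\<close> by (intro exI[of _ "G \<inter> ball p r"]) (auto simp: openin_open_Int)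
  qed (auto intro: linked_sym linked_trans)
qed

lemma strongly_connected_if_ball_chain_connected:
  fixes c :: "'a::metric_space \<Rightarrow> 'b::metric_space \<Rightarrow> ereal"
  assumes "ball_chain_connected c G"
  shows "strongly_connected c G"
  unfolding strongly_connected_iff_linked
proof (intro ballI)
  fix s e assume "s \<in> G" "e \<in> G"
  with assms obtain N z where z: "ball_chain c G s e N z"
    unfolding ball_chain_connected_def by blast
  have step: "linked c G (z k) (z (k + 1))" if "k \<in> {1..N}" for k
  proof -
    have "max_ball c (z k) \<inter> max_ball c (z (k + 1)) \<inter> G \<noteq> {}"
      using z that unfolding ball_chain_def by blast
    then obtain q where "q \<in> max_ball c (z k)" "q \<in> max_ball c (z (k + 1))" "q \<in> G"
      by blast
    moreover have "z k \<in> G" "z (k + 1) \<in> G"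
      using z that by (auto simp: ball_chain_def)
    ultimately show ?thesis
      by (meson linked_if_in_max_ball linked_sym linked_trans)
  qed
  have "linked c G s (z (k + 1))" if "1 \<le> k" "k \<le> N" for k
    using that
  proof (induction k rule: nat_induct_at_least)
    case base
    then show ?case using step[of 1] z by (simp add: ball_chain_def)
  next
    case (Suc k)
    then show ?case using step[of "Suc k"] by (auto intro: linked_trans)
  qed
  from this[of N] show "linked c G s e"
    using z by (simp add: ball_chain_def)
qed

section \<open>Path boundedness, antiderivatives and potentials\<close>

text \<open>
  A return path from \<open>e\<close> to \<open>s\<close>, with gain \<open>b\<close>, turns each path from \<open>s\<close> to \<open>e\<close> into a cycle,
  so \<open>- b\<close> bounds all gains. Here \<open>b\<close> has to be finite, which holds because a path only involves
  points of the domain.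
\<close>

lemma path_bounded_if_strongly_connected:
  assumes c: "\<And>x y. c x y \<noteq> -\<infinity>" and G: "G \<subseteq> cost_dom c"
    and conn: "strongly_connected c G" and mono: "cyclically_monotone c G"
  shows "path_bounded c G"
  unfolding path_bounded_def
proof (intro ballI)
  fix s e assume "s \<in> G" "e \<in> G"
  with conn obtain M w where w: "cost_path c G e s M w"
    unfolding strongly_connected_def by blast
  obtain b where b: "path_gain c M w = ereal b"
    using path_gain_finite[OF c G w] by auto
  have "path_sup c G s e \<le> ereal (- b)"
    unfolding path_sup_eq
  proof (rule Sup_least, clarify)
    fix N z assume z: "cost_path c G s e N z"
    obtain L v where v: "cost_path c G s s L v"
      and "path_gain c L v = path_gain c N z + path_gain c M w"
      using cost_path_append[OF z w] by blast
    moreover have "path_gain c L v \<le> 0"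
      using path_gain_le_path_sup[OF v] mono \<open>s \<in> G\<close>
      by (auto simp: cyclically_monotone_def)
    ultimately show "path_gain c N z \<le> ereal (- b)"
      using b by (cases "path_gain c N z") auto
  qed
  then show "path_sup c G s e < \<infinity>" by auto
qed

text \<open>
  Boundedness keeps \<open>F(z, t)\<close> below \<open>\<infinity>\<close>, and strong connectedness keeps it above \<open>-\<infinity>\<close>, since
  there is at least one path from \<open>z\<close> to \<open>t\<close>. When \<open>c u y = \<infinity>\<close> there is no step from
  \<open>(x, y)\<close> to \<open>(u, v)\<close>, but then the left-hand side of the required inequality is \<open>-\<infinity>\<close>.
\<close>

lemma antiderivative_if_path_bounded:
  assumes c: "\<And>x y. c x y \<noteq> -\<infinity>" and G: "G \<subseteq> cost_dom c"
    and conn: "strongly_connected c G" and bounded: "path_bounded c G" and "t \<in> G"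
  shows "antiderivative c G (\<lambda>z. real_of_ereal (path_sup c G z t))"
  unfolding antiderivative_def
proof clarify
  have finite: "\<bar>path_sup c G z t\<bar> \<noteq> \<infinity>" if "z \<in> G" for z
  proof -
    obtain N v where v: "cost_path c G z t N v"
      using conn \<open>z \<in> G\<close> \<open>t \<in> G\<close> unfolding strongly_connected_def by blast
    have "path_sup c G z t < \<infinity>"
      using bounded \<open>z \<in> G\<close> \<open>t \<in> G\<close> by (simp add: path_bounded_def)
    then show ?thesis
      using path_gain_le_path_sup[OF v] path_gain_finite[OF c G v] by auto
  qed
  fix x y u v assume xy: "(x, y) \<in> G" and uv: "(u, v) \<in> G"
  then obtain a where a: "c x y = ereal a"
    using G c[of x y] by (cases "c x y") (auto simp: cost_dom_def)
  obtain f where f: "path_sup c G (x, y) t = ereal f" using finite[OF xy] by auto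
  obtain g where g: "path_sup c G (u, v) t = ereal g" using finite[OF uv] by auto
  show "c x y - c u y
    \<le> ereal (real_of_ereal (path_sup c G (x, y) t) - real_of_ereal (path_sup c G (u, v) t))"
  proof (cases "c u y")
    case (real b)
    then obtain w where w: "cost_path c G (x, y) (u, v) 1 w"
      and gain: "path_gain c 1 w = ereal (a - b)"
      using cost_path_step[OF xy uv, of c] a by auto
    have "path_sup c G (u, v) t \<le> ereal (f - (a - b))"
      unfolding path_sup_eq
    proof (rule Sup_least, clarify)
      fix N z assume z: "cost_path c G (u, v) t N z"
      have "path_gain c 1 w + path_gain c N z \<le> ereal f"
        using cost_path_append[OF w z] path_gain_le_path_sup f by metis
      then show "path_gain c N z \<le> ereal (f - (a - b))"
        unfolding gain by (cases "path_gain c N z") auto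
    qed
    then show ?thesis using f g a real by simp
  qed (use a c[of u y] in auto)
qed

text \<open>
  With \<open>(u, v) \<in> G\<close> fixed, the defining inequality of an antiderivative reads
  \<open>c x y - f (x, y) \<le> c u y - f (u, v)\<close>. For \<open>v = y\<close> it makes \<open>\<phi> y = c x y - f (x, y)\<close>
  independent of \<open>x\<close>; for general \<open>y\<close>, after a supremum over \<open>x\<close>, it says that the
  infimum defining \<open>\<psi> u\<close> is attained at \<open>v\<close>, so that \<open>\<psi> u = f (u, v)\<close>. Transforming \<open>\<psi>\<close> back then gives \<open>\<phi>\<close> over \<open>G\<close>.
\<close>

lemma potentiable_if_antiderivative:
  assumes c: "\<And>x y. c x y \<noteq> -\<infinity>" and G: "G \<subseteq> cost_dom c"
    and f: "antiderivative c G f"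
  shows "potentiable c G"
proof -
  \<comment> \<open>The supremum picks the common value over \<open>y\<close>, and is \<open>-\<infinity>\<close> when \<open>G\<close> has no point over \<open>y\<close>.\<close>
  define \<phi> where "\<phi> y = Sup {c x y - ereal (f (x, y)) | x. (x, y) \<in> G}" for y
  define \<psi> where "\<psi> = cbar_transform c \<phi>"
  have anti: "c x y - c u y \<le> ereal (f (x, y) - f (u, v))" if "(x, y) \<in> G" "(u, v) \<in> G" for x y u v
    using f that unfolding antiderivative_def by blast
  have fin: "\<exists>r. c x y = ereal r" if "(x, y) \<in> cost_dom c" for x y
    using that c[of x y] by (cases "c x y") (auto simp: cost_dom_def)
  have \<phi>_le: "\<phi> y \<le> c u y - ereal (f (u, v))" if "(u, v) \<in> G" for y u v
    unfolding \<phi>_def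
  proof (rule Sup_least, clarify)
    fix x assume xy: "(x, y) \<in> G"
    with fin G obtain r where "c x y = ereal r" by blast
    then show "c x y - ereal (f (x, y)) \<le> c u y - ereal (f (u, v))"
      using anti[OF xy that] c[of u y] by (cases "c u y") auto
  qed
  have \<phi>_eq: "\<phi> y = c x y - ereal (f (x, y))" if "(x, y) \<in> G" for x y
    using that by (intro antisym \<phi>_le) (auto simp: \<phi>_def intro: Sup_upper)
  have \<psi>_le: "\<psi> x \<le> c x y - \<phi> y" if "(x, y) \<in> cost_dom c" for x y
    unfolding \<psi>_def cbar_transform_def using that by (intro Inf_lower) blast
  have \<psi>_eq: "\<psi> x = ereal (f (x, y))" if xy: "(x, y) \<in> G" for x y
  proof (rule antisym)
    obtain r where "c x y = ereal r" using fin G xy by blast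
    then show "\<psi> x \<le> ereal (f (x, y))"
      using \<psi>_le[of x y] \<phi>_eq[OF xy] G xy by auto
    show "ereal (f (x, y)) \<le> \<psi> x"
      unfolding \<psi>_def cbar_transform_def
    proof (rule Inf_greatest, clarify)
      fix v assume "(x, v) \<in> cost_dom c"
      with fin obtain r where "c x v = ereal r" by blast
      then show "ereal (f (x, y)) \<le> c x v - \<phi> v"
        using \<phi>_le[OF xy, of v] by (cases "\<phi> v") auto
    qed
  qed
  have "\<psi> x + c_transform c \<psi> y = c x y" if xy: "(x, y) \<in> G" for x y
  proof -
    obtain r where r: "c x y = ereal r" using fin G xy by blast
    have "c_transform c \<psi> y = ereal (r - f (x, y))"
    proof (rule antisym)
      have "c_transform c \<psi> y \<le> c x y - \<psi> x"
        unfolding c_transform_def using xy G by (intro Inf_lower) blast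
      then show "c_transform c \<psi> y \<le> ereal (r - f (x, y))"
        using r \<psi>_eq[OF xy] by simp
      show "ereal (r - f (x, y)) \<le> c_transform c \<psi> y"
        unfolding c_transform_def
      proof (rule Inf_greatest, clarify)
        fix u assume uy: "(u, y) \<in> cost_dom c"
        with fin obtain b where b: "c u y = ereal b" by blast
        then show "ereal (r - f (x, y)) \<le> c u y - \<psi> u"
          using \<psi>_le[OF uy] \<phi>_eq[OF xy] r by (cases "\<psi> u") auto
      qed
    qed
    then show ?thesis using r \<psi>_eq[OF xy] by simp
  qed
  moreover have "c_class c \<psi>" by (auto simp: c_class_def \<psi>_def)
  ultimately show ?thesis
    unfolding potentiable_def using \<psi>_eq G
    by (intro exI[of _ \<psi>]) (fastforce simp: cost_dom_def)
qed

theorem proposition4p6: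
  fixes c :: "'a::metric_space \<Rightarrow> 'b::metric_space \<Rightarrow> ereal"
    and G :: "('a \<times> 'b) set"
  assumes "\<And>x y. c x y \<noteq> -\<infinity>"
    and "cost_dom c \<noteq> {}"
    and "open (cost_dom c)"
    and "G \<noteq> {}"
    and "G \<subseteq> cost_dom c"
    and "connected G \<or> ball_chain_connected c G \<or> strongly_connected c G"
    and "cyclically_monotone c G"
  shows "path_bounded c G \<and> potentiable c G \<and> (\<exists>f. antiderivative c G f)"
proof -
  have conn: "strongly_connected c G"
    using assms(3,5,6) strongly_connected_if_connected
      strongly_connected_if_ball_chain_connected by blast
  then have bounded: "path_bounded c G"
    using assms path_bounded_if_strongly_connected by blast
  obtain t where "t \<in> G" using assms(4) by blast
  then have "antiderivative c G (\<lambda>z. real_of_ereal (path_sup c G z t))"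
    using antiderivative_if_path_bounded[OF assms(1,5) conn bounded] by blast
  then show ?thesis
    using bounded potentiable_if_antiderivative[OF assms(1,5)] by blast
qed

end
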